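(* Assume (A1), (A2) and (A3) of the context. Let $\{(x^k,\epsilon^k)\}$ be generated by the algorithm DIRL$_1$ and let $\Omega$ be the set of limit points of $\{x^k\}$. Then $\epsilon^*:=\lim_{k\to\infty}\epsilon^k=0$, $\Omega\ne\emptyset$, and every $x^*\in\Omega$ is a stationary point of the problem $\min_x F(x)$.
   Context: Let $f:\mathbb R^n\to\mathbb R$ be twice continuously differentiable, $\lambda>0$, $F(x)=f(x)+\lambda\sum_{i=1}^n r(|x_i|)$. (A1) $r:[0,\infty)\to\mathbb R$ is continuous and concave, $r(0)=0$, $C^2$ on $(0,\infty)$, $r'(t)\ge0$ for all $t>0$, and $r'(0^+):=\lim_{t\to0^+}r'(t)\in(0,\infty]$. (A2) Every $x$ with $0\in\partial F(x)$ satisfies $0\in\mathrm{rint}\,\partial F(x)$ ($\partial F$ the regular subdifferential, $\mathrm{rint}$ the relative interior). Let $\mathcal I(x)=\{i:x_i\ne0\}$, $\mathcal J(x)=\{i:x_i=0\}$. A point $x^*$ is stationary if $\nabla_i f(x^* )=-\lambda\,\mathrm{sign}(x_i^* )r'(|x_i^*|)$ for $i\in\mathcal I(x^* )$ and $\nabla_i f(x^* )\in(-\lambda r'(0^+),\lambda r'(0^+))$ for $i\in\mathcal J(x^* )$. Put $F(x,\epsilon)=f(x)+\lambda\sum_{i=1}^n r(|x_i|+\epsilon_i)$ for $\epsilon\in\mathbb R^n_+$. (A3) For the initial point $(x^0,\epsilon^0)$ and $F^0=F(x^0,\epsilon^0)$, the level set $\mathcal L(F^0)=\{x:F(x)\le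 F^0\}$ is bounded. Let $L_{\nabla f}$ be a constant with $\|\nabla f(x)-\nabla f(y)\|\le L_{\nabla f}\|x-y\|$ for all $x,y\in\mathcal L(F^0)$. DIRL$_1$: input $x^0\in\mathbb R^n$, $\epsilon^0\in\mathbb R^n$ with all entries positive, $\alpha,\mu\in(0,1)$, $\beta>\alpha L_{\nabla f}/2$, $\beta>0$. For $k=0,1,2,\dots$: $w_i^k=r'(|x_i^k|+\epsilon_i^k)$; $y^k=\arg\min_{y\in\mathbb R^n}\{\nabla f(x^k)^T(y-x^k)+\frac\beta2\|y-x^k\|^2+\lambda\sum_{i=1}^n w_i^k|y_i|\}$; $x^{k+1}=(1-\alpha)x^k+\alpha y^k$; $\epsilon^{k+1}=(1-\alpha(1-\mu))\epsilon^k$. *)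

theory Defs
  imports "HOL-Analysis.Analysis"
begin

text \<open>Only used for open sets \<open>S\<close>.\<close>
definition C2_on :: "('a::real_normed_vector \<Rightarrow> 'b::real_normed_vector) \<Rightarrow> 'a set \<Rightarrow> bool" where
  "C2_on f S \<longleftrightarrow>
     (\<exists>(D1 :: 'a \<Rightarrow> ('a \<Rightarrow>\<^sub>L 'b)) (D2 :: 'a \<Rightarrow> ('a \<Rightarrow>\<^sub>L ('a \<Rightarrow>\<^sub>L 'b))).
        (\<forall>x\<in>S. (f has_derivative blinfun_apply (D1 x)) (at x)) \<and>
        (\<forall>x\<in>S. (D1 has_derivative blinfun_apply (D2 x)) (at x)) \<and>
        continuous_on S D2)"

definition grad :: "('a::euclidean_space \<Rightarrow> real) \<Rightarrow> 'a \<Rightarrow> 'a" where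
  "grad f x = (THE g. GDERIV f x :> g)"

text \<open>The value \<open>r'(0\<^sup>+)\<close>, possibly \<open>\<infinity>\<close>; meaningful when the limit exists.\<close>
definition deriv0 :: "(real \<Rightarrow> real) \<Rightarrow> ereal" where
  "deriv0 r = Lim (at_right 0) (\<lambda>t. ereal (deriv r t))"

text \<open>The regularizer is a function on \<open>[0,\<infinity>)\<close>; its values at negative arguments are
  unconstrained and never used.\<close>
definition A1 :: "(real \<Rightarrow> real) \<Rightarrow> bool" where
  "A1 r \<longleftrightarrow>
     continuous_on {0..} r \<and> concave_on {0..} r \<and> r 0 = 0 \<and> C2_on r {0<..} \<and>
     (\<forall>t>0. deriv r t \<ge> 0) \<and>
     ((\<lambda>t. ereal (deriv r t)) \<longlongrightarrow> deriv0 r) (at_right 0) \<and> deriv0 r > 0"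

definition smoothed_objective ::
    "(real ^ 'n \<Rightarrow> real) \<Rightarrow> (real \<Rightarrow> real) \<Rightarrow> real \<Rightarrow> real ^ 'n \<Rightarrow> real ^ 'n \<Rightarrow> real" where
  "smoothed_objective f r lam x eps = f x + lam * (\<Sum>i\<in>UNIV. r (\<bar>x $ i\<bar> + eps $ i))"

definition objective ::
    "(real ^ 'n \<Rightarrow> real) \<Rightarrow> (real \<Rightarrow> real) \<Rightarrow> real \<Rightarrow> real ^ 'n \<Rightarrow> real" where
  "objective f r lam x = f x + lam * (\<Sum>i\<in>UNIV. r \<bar>x $ i\<bar>)"

text \<open>Regular (Frechet) subdifferential: \<open>v\<close> with
  \<open>F y \<ge> F x + v \<bullet> (y - x) + o(norm (y - x))\<close>.\<close>
definition regular_subdifferential ::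
    "('a::euclidean_space \<Rightarrow> real) \<Rightarrow> 'a \<Rightarrow> 'a set" where
  "regular_subdifferential F x =
     {v. 0 \<le> Liminf (at x) (\<lambda>y. ereal ((F y - F x - v \<bullet> (y - x)) / norm (y - x)))}"

definition A2 :: "(real ^ 'n \<Rightarrow> real) \<Rightarrow> bool" where
  "A2 F \<longleftrightarrow>
     (\<forall>x. 0 \<in> regular_subdifferential F x \<longrightarrow>
          0 \<in> rel_interior (regular_subdifferential F x))"

definition stationary ::
    "(real ^ 'n \<Rightarrow> real) \<Rightarrow> (real \<Rightarrow> real) \<Rightarrow> real \<Rightarrow> real ^ 'n \<Rightarrow> bool" where
  "stationary f r lam x \<longleftrightarrow>
     (\<forall>i. x $ i \<noteq> 0 \<longrightarrow> grad f x $ i = - lam * sgn (x $ i) * deriv r \<bar>x $ i\<bar>) \<and>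
     (\<forall>i. x $ i = 0 \<longrightarrow>
        ereal (grad f x $ i) \<in> {- (ereal lam * deriv0 r) <..< ereal lam * deriv0 r})"

definition subproblem ::
    "(real ^ 'n \<Rightarrow> real) \<Rightarrow> real \<Rightarrow> real \<Rightarrow> real ^ 'n \<Rightarrow> real ^ 'n \<Rightarrow> real ^ 'n \<Rightarrow> real" where
  "subproblem f lam beta x w y =
     grad f x \<bullet> (y - x) + beta / 2 * (norm (y - x))\<^sup>2 + lam * (\<Sum>i\<in>UNIV. w $ i * \<bar>y $ i\<bar>)"

text \<open>\<open>xs\<close> and \<open>es\<close> are the iterates generated from \<open>(xs 0, es 0)\<close>.\<close>
definition DIRL1 ::
    "(real ^ 'n \<Rightarrow> real) \<Rightarrow> (real \<Rightarrow> real) \<Rightarrow> real \<Rightarrow> real \<Rightarrow> real \<Rightarrow> real \<Rightarrow>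
     (nat \<Rightarrow> real ^ 'n) \<Rightarrow> (nat \<Rightarrow> real ^ 'n) \<Rightarrow> bool" where
  "DIRL1 f r lam alpha beta mu xs es \<longleftrightarrow>
     (\<exists>(w :: nat \<Rightarrow> real ^ 'n) (y :: nat \<Rightarrow> real ^ 'n). \<forall>k.
        (\<forall>i. w k $ i = deriv r (\<bar>xs k $ i\<bar> + es k $ i)) \<and>
        is_arg_min (subproblem f lam beta (xs k) (w k)) (\<lambda>_. True) (y k) \<and>
        xs (Suc k) = (1 - alpha) *\<^sub>R xs k + alpha *\<^sub>R y k \<and>
        es (Suc k) = (1 - alpha * (1 - mu)) *\<^sub>R es k)"

definition limit_points :: "(nat \<Rightarrow> 'a::topological_space) \<Rightarrow> 'a set" where
  "limit_points xs = {l. \<exists>s. strict_mono s \<and> (xs \<circ> s) \<longlonglongrightarrow> l}"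

end

theory Submission
  imports Defs
begin

text \<open>Concavity of \<open>r\<close> turns the subproblem into a majorization step, so that strong convexity
  gives \<open>F(x\<^sup>k\<^sup>+\<^sup>1, \<epsilon>\<^sup>k\<^sup>+\<^sup>1) \<le> F(x\<^sup>k, \<epsilon>\<^sup>k) - c \<parallel>y\<^sup>k - x\<^sup>k\<parallel>\<^sup>2\<close>. The Lipschitz bound is only available
  on a level set that need not be convex; a first-exit-time argument shows that the segment from
  \<open>x\<^sup>k\<close> to \<open>x\<^sup>k\<^sup>+\<^sup>1\<close> stays inside it. Hence \<open>y\<^sup>k - x\<^sup>k \<rightarrow> 0\<close>, and the optimality conditions of the
  subproblem pass to the limit, with a weak inequality \<open>\<bar>\<nabla>\<^sub>i f\<bar> \<le> \<lambda> r'(0\<^sup>+)\<close> on the zero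
  coordinates. If \<open>r'(0\<^sup>+)\<close> is finite, this says that \<open>0\<close> is a regular subgradient, and (A2) makes
  the inequality strict; if it is infinite, strictness is automatic.\<close>

section \<open>Gradients\<close>

text \<open>Because \<open>grad\<close> is a definite description, a gradient has to be exhibited
  and shown unique before anything can be said about it. It is the Riesz vector of the derivative,
  obtained by applying the adjoint of \<open>D1 x\<close> to 1. Its coordinates are values of
  \<open>D1\<close> at basis vectors, so it inherits the continuity of \<open>D1\<close>.\<close>

lemma C2_on_has_derivative_grad:
  fixes f :: "'a::euclidean_space \<Rightarrow> real"
  assumes "C2_on f UNIV"
  shows "(f has_derivative (\<lambda>h. h \<bullet> grad f x)) (at x)"
    and "continuous_on UNIV (grad f)"
proof -
  obtain D1 :: "'a \<Rightarrow> ('a \<Rightarrow>\<^sub>L real)" and D2 :: "'a \<Rightarrow> ('a \<Rightarrow>\<^sub>L ('a \<Rightarrow>\<^sub>L real))"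
    where D1: "\<And>x. (f has_derivative blinfun_apply (D1 x)) (at x)"
      and D2: "\<And>x. (D1 has_derivative blinfun_apply (D2 x)) (at x)"
    using assms unfolding C2_on_def by blast
  define g where "g x = adjoint (blinfun_apply (D1 x)) 1" for x
  have g: "h \<bullet> g x = D1 x h" for x h
    unfolding g_def by (subst adjoint_works) (auto simp: blinfun.bounded_linear_right bounded_linear.linear)
  have "GDERIV f x :> g x" for x
    using D1[of x] by (simp add: gderiv_def g)
  moreover have "a = g x" if "GDERIV f x :> a" for x a
  proof -
    have "(\<lambda>h. h \<bullet> a) = (\<lambda>h. h \<bullet> g x)"
      using that \<open>GDERIV f x :> g x\<close> unfolding gderiv_def by (rule has_derivative_unique)
    then show ?thesis by (metis vector_eq_ldot)
  qed
  ultimately have grad: "grad f x = g x" for x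
    unfolding grad_def by (intro the_equality) auto
  show "(f has_derivative (\<lambda>h. h \<bullet> grad f x)) (at x)"
    using D1[of x] by (simp add: grad g)
  have D1c: "continuous_on UNIV D1"
    by (intro continuous_at_imp_continuous_on ballI has_derivative_continuous[OF D2])
  show "continuous_on UNIV (grad f)"
  proof (rule continuous_on_componentwise[THEN iffD2], intro ballI)
    fix b :: 'a
    show "continuous_on UNIV (\<lambda>x. grad f x \<bullet> b)"
      unfolding grad inner_commute[of _ b] g
      by (intro continuous_intros D1c)
  qed
qed

lemma has_derivative_inner_approx:
  fixes f :: "'a::euclidean_space \<Rightarrow> real"
  assumes "(f has_derivative (\<lambda>h. h \<bullet> g)) (at x)" "e > 0"
  shows "eventually (\<lambda>y. \<bar>f y - f x - g \<bullet> (y - x)\<bar> \<le> e * norm (y - x)) (nhds x)"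
proof -
  obtain d where "d > 0" "\<And>y. norm (y - x) < d \<Longrightarrow> norm (f y - f x - (y - x) \<bullet> g) \<le> e * norm (y - x)"
    using assms unfolding has_derivative_at_alt by blast
  then show ?thesis
    unfolding eventually_nhds_metric dist_norm real_norm_def inner_commute[of g]
    by (intro exI[of _ d]) simp
qed

lemma has_real_derivative_abs:
  fixes z :: real
  assumes "z \<noteq> 0"
  shows "((\<lambda>s. \<bar>s\<bar>) has_real_derivative sgn z) (at z)"
proof -
  have "norm = (abs :: real \<Rightarrow> real)" by (rule ext) simp
  then show ?thesis
    using has_derivative_norm[OF assms] by (simp add: has_field_derivative_def mult.commute[of _ "sgn z"])
qed

section \<open>The regularizer\<close>

text \<open>On the real line the operator \<open>D1 t\<close> is multiplication by
  \<open>D1 t 1\<close>, which turns the operator-valued derivatives of \<open>C2_on\<close> into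
  ordinary ones. Continuity transfers because \<open>deriv r\<close> agrees with
  \<open>D1 _ 1\<close> on a whole neighbourhood of each positive \<open>t\<close>.\<close>

lemma A1_deriv:
  assumes "A1 r"
  shows "t > 0 \<Longrightarrow> (r has_real_derivative deriv r t) (at t)"
    and "t > 0 \<Longrightarrow> isCont (deriv r) t"
    and "t > 0 \<Longrightarrow> deriv r t \<ge> 0"
proof -
  obtain D1 :: "real \<Rightarrow> (real \<Rightarrow>\<^sub>L real)" and D2 :: "real \<Rightarrow> (real \<Rightarrow>\<^sub>L (real \<Rightarrow>\<^sub>L real))"
    where D1: "\<And>x. x > 0 \<Longrightarrow> (r has_derivative blinfun_apply (D1 x)) (at x)"
      and D2: "\<And>x. x > 0 \<Longrightarrow> (D1 has_derivative blinfun_apply (D2 x)) (at x)"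
    using assms unfolding A1_def C2_on_def by (metis greaterThan_iff)
  have 1: "(r has_real_derivative D1 t 1) (at t)" if "t > 0" for t
  proof -
    have "blinfun_apply (D1 t) = (*) (D1 t 1)"
    proof
      show "D1 t h = D1 t 1 * h" for h
        using blinfun.scaleR_right[of "D1 t" h 1] 
        by (simp only: real_scaleR_def mult_1_right mult_1_left mult.commute[of h])
    qed
    then show ?thesis
      using D1[OF that] by (simp add: has_field_derivative_def)
  qed
  have eq: "deriv r t = D1 t 1" if "t > 0" for t
    using 1[OF that] by (rule DERIV_imp_deriv)
  show "(r has_real_derivative deriv r t) (at t)" if "t > 0"
    using 1 eq that by simp
  show "deriv r t \<ge> 0" if "t > 0"
    using assms that by (simp add: A1_def)
  show "isCont (deriv r) t" if "t > 0"
  proof -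
    have "isCont (\<lambda>t. D1 t 1) t"
      using D2[OF that] by (intro continuous_intros) (rule has_derivative_continuous)
    moreover have "eventually (\<lambda>s. deriv r s = D1 s 1) (nhds t)"
      using eventually_nhds_in_open[of "{0<..}" t] that by (auto elim!: eventually_mono simp: eq)
    ultimately show ?thesis
      by (simp add: isCont_cong)
  qed
qed

text \<open>The convex function \<open>- r\<close> lies above its tangent at the interior point
  \<open>s\<close>. The other point may be 0, where \<open>r\<close> itself can have infinite slope;
  the later estimates at 0 depend on this.\<close>

lemma A1_tangent:
  assumes "A1 r" "s > 0" "t \<ge> 0"
  shows "r t \<le> r s + deriv r s * (t - s)"
proof -
  have "convex_on {0..} (\<lambda>x. - r x)"
    using assms(1) by (simp add: A1_def concave_on_def)
  moreover have "((\<lambda>x. - r x) has_field_derivative - deriv r s) (at s within {0..})"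
    using A1_deriv(1)[OF assms(1,2)]
    by (intro derivative_intros) (auto intro: has_field_derivative_at_within)
  ultimately have "- r t - (- r s) \<ge> (- deriv r s) * (t - s)"
    using assms by (intro convex_on_imp_above_tangent[where A = "{0..}"]) (auto simp: interior_Ici)
  then show ?thesis by simp
qed

text \<open>Adding the tangent inequalities at \<open>s\<close> and at \<open>t\<close> cancels the
  values of \<open>r\<close>.\<close>

lemma A1_deriv_antimono:
  assumes "A1 r" "0 < s" "s \<le> t"
  shows "deriv r t \<le> deriv r s"
proof (cases "s = t")
  case False
  have "r t \<le> r s + deriv r s * (t - s)" "r s \<le> r t + deriv r t * (s - t)"
    using assms by (auto intro!: A1_tangent)
  then have "(deriv r t - deriv r s) * (t - s) \<le> 0"
    by (simp add: algebra_simps)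
  then show ?thesis
    using False assms by (simp add: mult_le_0_iff)
qed simp

text \<open>The tangent is taken at the larger point \<open>t\<close>, so that \<open>s = 0\<close>
  is covered without a derivative there.\<close>

lemma A1_mono:
  assumes "A1 r" "0 \<le> s" "s \<le> t"
  shows "r s \<le> r t"
proof (cases "t > 0")
  case True
  have "r s \<le> r t + deriv r t * (s - t)"
    using assms True by (auto intro!: A1_tangent)
  moreover have "deriv r t * (s - t) \<le> 0"
    using A1_deriv(3)[OF assms(1) True] assms by (simp add: mult_le_0_iff)
  ultimately show ?thesis by simp
next
  case False
  then have "s = t" using assms by simp
  then show ?thesis by simp
qed

lemma A1_nonneg: "A1 r \<Longrightarrow> 0 \<le> t \<Longrightarrow> 0 \<le> r t"
  using A1_mono[of r 0 t] by (simp add: A1_def)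

text \<open>Since \<open>deriv r\<close> is antitone, its right limit at 0 dominates all its
  values.\<close>

lemma A1_deriv_le_deriv0:
  assumes "A1 r" "t > 0"
  shows "ereal (deriv r t) \<le> deriv0 r"
proof (rule tendsto_lowerbound)
  show "((\<lambda>t. ereal (deriv r t)) \<longlongrightarrow> deriv0 r) (at_right 0)"
    using assms by (simp add: A1_def)
  show "eventually (\<lambda>s. ereal (deriv r t) \<le> ereal (deriv r s)) (at_right 0)"
    unfolding eventually_at_right_field using assms A1_deriv_antimono[OF assms(1)]
    by (intro exI[of _ t]) auto
qed simp

text \<open>The tangent at a small \<open>s > 0\<close> has slope at most \<open>R\<close>; letting
  \<open>s\<close> tend to 0 uses only the continuity of \<open>r\<close> at 0.\<close>

lemma A1_le_deriv0_linear:
  assumes "A1 r" "deriv0 r = ereal R" "t \<ge> 0"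
  shows "r t \<le> R * t"
proof (cases "t = 0")
  case False
  with assms have t: "t > 0" by simp
  have R: "0 < R" using assms by (simp add: A1_def)
  have "r t \<le> r s + R * t" if "0 < s" "s < t" for s
  proof -
    have "r t \<le> r s + deriv r s * (t - s)"
      using assms that by (intro A1_tangent) auto
    also have "deriv r s * (t - s) \<le> R * t"
      using A1_deriv_le_deriv0[OF assms(1), of s] A1_deriv(3)[OF assms(1), of s] assms that R
      by (intro mult_mono) auto
    finally show ?thesis by simp
  qed
  then have "eventually (\<lambda>s. r t \<le> r s + R * t) (at_right 0)"
    unfolding eventually_at_right_field using t by blast
  moreover have "((\<lambda>s. r s + R * t) \<longlongrightarrow> r 0 + R * t) (at_right 0)"
  proof -
    have "continuous_on {0..} r" using assms by (simp add: A1_def)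
    then have "(r \<longlongrightarrow> r 0) (at 0 within {0..})" by (simp add: continuous_on_def)
    then have "(r \<longlongrightarrow> r 0) (at_right 0)"
      by (rule tendsto_within_subset) auto
    then show ?thesis by (intro tendsto_intros)
  qed
  ultimately have "r t \<le> r 0 + R * t"
    using tendsto_lowerbound trivial_limit_at_right_real by blast
  then show ?thesis using assms by (simp add: A1_def)
qed (use assms in \<open>simp add: A1_def\<close>)

text \<open>Near 0 the slope exceeds \<open>R - e\<close>, and the tangent at
  \<open>\<bar>s\<bar>\<close> evaluated at 0, where \<open>r\<close> vanishes, gives
  \<open>r \<bar>s\<bar> \<ge> deriv r \<bar>s\<bar> * \<bar>s\<bar>\<close>.\<close>

lemma A1_ge_deriv0_linear:
  assumes "A1 r" "deriv0 r = ereal R" "e > 0"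
  shows "eventually (\<lambda>s. r \<bar>s\<bar> \<ge> (R - e) * \<bar>s\<bar>) (nhds (0::real))"
proof -
  have "((\<lambda>t. ereal (deriv r t)) \<longlongrightarrow> ereal R) (at_right 0)"
    using assms by (simp add: A1_def)
  then have "(deriv r \<longlongrightarrow> R) (at_right 0)" by simp
  then have "eventually (\<lambda>t. deriv r t > R - e) (at_right 0)"
    using assms by (intro order_tendstoD) auto
  then obtain b where b: "b > 0" "\<And>t. 0 < t \<Longrightarrow> t < b \<Longrightarrow> deriv r t > R - e"
    unfolding eventually_at_right_field by auto
  have "r \<bar>s\<bar> \<ge> (R - e) * \<bar>s\<bar>" if "\<bar>s\<bar> < b" for s
  proof (cases "s = 0")
    case False
    have "r 0 \<le> r \<bar>s\<bar> + deriv r \<bar>s\<bar> * (0 - \<bar>s\<bar>)"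
      using False assms by (intro A1_tangent) auto
    moreover have "r 0 = 0" using assms by (simp add: A1_def)
    moreover have "(R - e) * \<bar>s\<bar> \<le> deriv r \<bar>s\<bar> * \<bar>s\<bar>"
      using b(2)[of "\<bar>s\<bar>"] False that by (intro mult_right_mono) auto
    ultimately show ?thesis by simp
  qed (use assms in \<open>simp add: A1_def\<close>)
  then show ?thesis
    unfolding eventually_nhds_metric dist_real_def using b(1) by auto
qed

section \<open>The regular subdifferential of the objective\<close>

text \<open>Trades the extended-real \<open>Liminf\<close> of quotients for real inequalities that
  can be added; multiplying by \<open>norm (y - x)\<close> is harmless because \<open>at x\<close>
  excludes \<open>y = x\<close>.\<close>

lemma regular_subdifferential_iff:
  "v \<in> regular_subdifferential F x \<longleftrightarrow>
     (\<forall>e>0. eventually (\<lambda>y. F y - F x - v \<bullet> (y - x) \<ge> - e * norm (y - x)) (at x))"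
    (is "?L = ?R")
proof -
  let ?q = "\<lambda>y. (F y - F x - v \<bullet> (y - x)) / norm (y - x)"
  have ev: "eventually (\<lambda>y. - e \<le> ?q y) (at x) \<longleftrightarrow>
      eventually (\<lambda>y. F y - F x - v \<bullet> (y - x) \<ge> - e * norm (y - x)) (at x)" for e
    by (rule eventually_subst) (simp add: eventually_at_filter pos_le_divide_eq)
  have "?L \<longleftrightarrow> (\<forall>c<0. eventually (\<lambda>y. c < ereal (?q y)) (at x))"
    by (simp add: regular_subdifferential_def le_Liminf_iff)
  also have "\<dots> \<longleftrightarrow> (\<forall>e>0. eventually (\<lambda>y. - e \<le> ?q y) (at x))"
  proof (intro iffI allI impI)
    fix e :: real assume *: "\<forall>c<0. eventually (\<lambda>y. c < ereal (?q y)) (at x)" and "e > 0"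
    then have "ereal (- e) < 0" by simp
    with * have "eventually (\<lambda>y. ereal (- e) < ereal (?q y)) (at x)" by blast
    then show "eventually (\<lambda>y. - e \<le> ?q y) (at x)" by (rule eventually_mono) simp
  next
    fix c :: ereal assume *: "\<forall>e>0. eventually (\<lambda>y. - e \<le> ?q y) (at x)" and "c < 0"
    \<comment> \<open>Halving a finite \<open>c\<close> leaves the strict gap; for minus infinity
      any \<open>e\<close> serves.\<close>
    then obtain e where e: "c < ereal (- e)" "e > 0"
    proof (cases c)
      case (real a)
      then show ?thesis using \<open>c < 0\<close> that[of "- a / 2"] by simp
    next
      case MInf
      then show ?thesis using that[of 1] by simp
    qed simp
    have "eventually (\<lambda>y. - e \<le> ?q y) (at x)" using * e(2) by blast
    then show "eventually (\<lambda>y. c < ereal (?q y)) (at x)"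
      by (rule eventually_mono) (rule less_le_trans[OF e(1)], simp)
  qed
  finally show ?thesis unfolding ev .
qed

text \<open>The one-dimensional subgradient inequality: away from 0 the function is differentiable
  with derivative \<open>u\<close>, while at 0 the kink of slope \<open>lam * R\<close> absorbs
  \<open>u\<close>. The filter is \<open>nhds\<close> and not \<open>at\<close>, because the
  inequality is later pulled back along \<open>y \<mapsto> y $ i\<close>, and \<open>y $ i\<close>
  may equal \<open>x $ i\<close> although \<open>y \<noteq> x\<close>.\<close>

lemma abs_reg_lower_approx:
  assumes "A1 r" "deriv0 r = ereal R" "e > 0" "lam > 0"
    and nz: "z \<noteq> 0 \<Longrightarrow> u = lam * sgn z * deriv r \<bar>z\<bar>"
    and z: "z = 0 \<Longrightarrow> \<bar>u\<bar> \<le> lam * R"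
  shows "eventually (\<lambda>s. lam * r \<bar>s\<bar> - lam * r \<bar>z\<bar> - u * (s - z) \<ge> - e * \<bar>s - z\<bar>) (nhds z)"
proof (cases "z = 0")
  case True
  have "eventually (\<lambda>s. r \<bar>s\<bar> \<ge> (R - e / lam) * \<bar>s\<bar>) (nhds (0::real))"
    using assms by (intro A1_ge_deriv0_linear) auto
  then show ?thesis unfolding True
  proof eventually_elim
    case (elim s)
    have "u * s \<le> lam * R * \<bar>s\<bar>"
      using z[OF True] abs_ge_self[of "u * s"] mult_right_mono[of "\<bar>u\<bar>" "lam * R" "\<bar>s\<bar>"]
      by (simp add: abs_mult)
    moreover have "lam * ((R - e / lam) * \<bar>s\<bar>) \<le> lam * r \<bar>s\<bar>"
      using elim assms by (intro mult_left_mono) auto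
    moreover have "lam * ((R - e / lam) * \<bar>s\<bar>) = lam * R * \<bar>s\<bar> - e * \<bar>s\<bar>"
      using assms by (simp add: field_simps)
    moreover have "r 0 = 0" using assms by (simp add: A1_def)
    ultimately show ?case by simp
  qed
next
  case False
  have "((\<lambda>s. lam * r \<bar>s\<bar>) has_real_derivative u) (at z)"
  proof -
    have "((\<lambda>s. \<bar>s\<bar>) has_real_derivative sgn z) (at z)"
      using False by (rule has_real_derivative_abs)
    then have "((\<lambda>s. r \<bar>s\<bar>) has_real_derivative deriv r \<bar>z\<bar> * sgn z) (at z)"
      using A1_deriv(1)[OF assms(1), of "\<bar>z\<bar>"] False by (intro DERIV_chain2) auto
    from DERIV_cmult[OF this, of lam] show ?thesis
      using nz[OF False] by (simp add: mult_ac)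
  qed
  then have "((\<lambda>s. lam * r \<bar>s\<bar>) has_derivative (\<lambda>h. h \<bullet> u)) (at z)"
    by (simp add: has_field_derivative_def mult.commute[of _ u] )
  from has_derivative_inner_approx[OF this \<open>e > 0\<close>] show ?thesis
    by eventually_elim auto
qed

lemma sum_abs_component_le_norm:
  fixes h :: "real ^ 'n"
  shows "(\<Sum>i\<in>UNIV. \<bar>h $ i\<bar>) \<le> CARD('n) * norm h"
  using sum_bounded_above[of UNIV "\<lambda>i. \<bar>h $ i\<bar>" "norm h"] component_le_norm_cart[of h] by simp

text \<open>The objective is a differentiable function plus a separable one, so the first-order
  expansion of \<open>f\<close> and the one-dimensional inequalities for the coordinates of
  \<open>v - g\<close> can be added.\<close>

lemma mem_regular_subdifferential_objective:
  fixes f :: "real ^ 'n \<Rightarrow> real"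
  assumes "A1 r" "deriv0 r = ereal R" "lam > 0"
    and f: "(f has_derivative (\<lambda>h. h \<bullet> g)) (at x)"
    and nz: "\<And>i. x $ i \<noteq> 0 \<Longrightarrow> v $ i - g $ i = lam * sgn (x $ i) * deriv r \<bar>x $ i\<bar>"
    and z: "\<And>i. x $ i = 0 \<Longrightarrow> \<bar>v $ i - g $ i\<bar> \<le> lam * R"
  shows "v \<in> regular_subdifferential (objective f r lam) x"
  unfolding regular_subdifferential_iff
proof (intro allI impI)
  fix e :: real assume e: "e > 0"
  \<comment> \<open>One share of the error goes to \<open>f\<close>; the coordinates together cost
    \<open>CARD('n)\<close> shares, by \<open>sum_abs_component_le_norm\<close>.\<close>
  define e' where "e' = e / (1 + CARD('n))"
  have e': "e' > 0" using e by (simp add: e'_def add_pos_nonneg)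
  have ee: "e' + CARD('n) * e' = e"
  proof -
    have "(1 + real CARD('n)) * e' = e" by (simp add: e'_def add_nonneg_eq_0_iff)
    then show ?thesis by (simp only: distrib_right mult_1_left)
  qed
  have "eventually (\<lambda>y. lam * r \<bar>y $ i\<bar> - lam * r \<bar>x $ i\<bar> - (v $ i - g $ i) * (y $ i - x $ i)
          \<ge> - e' * \<bar>y $ i - x $ i\<bar>) (nhds x)" for i
  proof -
    have "((\<lambda>y. y $ i) \<longlongrightarrow> x $ i) (nhds x)" by (intro tendsto_intros filterlim_ident)
    from this[unfolded filterlim_iff, rule_format, OF abs_reg_lower_approx[OF assms(1,2) e' assms(3) nz z]]
    show ?thesis .
  qed
  then have "eventually (\<lambda>y. \<forall>i. lam * r \<bar>y $ i\<bar> - lam * r \<bar>x $ i\<bar> - (v $ i - g $ i) * (y $ i - x $ i)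
          \<ge> - e' * \<bar>y $ i - x $ i\<bar>) (nhds x)"
    by (simp add: eventually_all_finite)
  with has_derivative_inner_approx[OF f e']
  have "eventually (\<lambda>y. objective f r lam y - objective f r lam x - v \<bullet> (y - x) \<ge> - e * norm (y - x)) (nhds x)"
  proof eventually_elim
    case (elim y)
    have "(\<Sum>i\<in>UNIV. - e' * \<bar>y $ i - x $ i\<bar>) \<le>
       (\<Sum>i\<in>UNIV. lam * r \<bar>y $ i\<bar> - lam * r \<bar>x $ i\<bar> - (v $ i - g $ i) * (y $ i - x $ i))"
      using elim by (intro sum_mono) auto
    also have "\<dots> = lam * (\<Sum>i\<in>UNIV. r \<bar>y $ i\<bar>) - lam * (\<Sum>i\<in>UNIV. r \<bar>x $ i\<bar>) - (v - g) \<bullet> (y - x)"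
      by (simp add: sum_subtractf sum_distrib_left inner_vec_def)
    finally have 1: "- (e' * (\<Sum>i\<in>UNIV. \<bar>(y - x) $ i\<bar>)) \<le> \<dots>"
      by (simp add: sum_distrib_left sum_negf)
    have "e' * (\<Sum>i\<in>UNIV. \<bar>(y - x) $ i\<bar>) \<le> e' * (CARD('n) * norm (y - x))"
      using e' by (intro mult_left_mono sum_abs_component_le_norm) auto
    moreover have "e' * norm (y - x) + e' * (CARD('n) * norm (y - x)) = e * norm (y - x)"
      unfolding ee[symmetric] by (simp only: distrib_right distrib_left mult_ac)
    moreover have "objective f r lam y - objective f r lam x =
        f y - f x + (lam * (\<Sum>i\<in>UNIV. r \<bar>y $ i\<bar>) - lam * (\<Sum>i\<in>UNIV. r \<bar>x $ i\<bar>))"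
      by (simp add: objective_def)
    moreover have "v \<bullet> (y - x) = (v - g) \<bullet> (y - x) + g \<bullet> (y - x)" by (simp add: inner_diff_left)
    moreover have "f y - f x - g \<bullet> (y - x) \<ge> - (e' * norm (y - x))" using elim(1) by linarith
    ultimately show ?case using 1 by linarith
  qed
  then show "eventually (\<lambda>y. objective f r lam y - objective f r lam x - v \<bullet> (y - x) \<ge> - e * norm (y - x)) (at x)"
    by (simp add: eventually_at_filter eventually_mono)
qed

text \<open>The subgradient inequality is tested along the \<open>i\<close>-th axis, where the
  regularizer grows by at most \<open>lam * R * \<bar>s\<bar>\<close>. Steps of both signs give the
  absolute value; half of the error \<open>e\<close> pays for the subgradient, half for the
  expansion of \<open>f\<close>.\<close>

lemma regular_subdifferential_objective_bound:
  fixes f :: "real ^ 'n \<Rightarrow> real"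
  assumes "A1 r" "deriv0 r = ereal R" "lam > 0"
    and f: "(f has_derivative (\<lambda>h. h \<bullet> g)) (at x)"
    and v: "v \<in> regular_subdifferential (objective f r lam) x"
    and i: "x $ i = 0"
  shows "\<bar>v $ i - g $ i\<bar> \<le> lam * R"
proof (rule field_le_epsilon)
  fix e :: real assume e: "e > 0"
  have "eventually (\<lambda>y. objective f r lam y - objective f r lam x - v \<bullet> (y - x) \<ge> - (e/2) * norm (y - x)) (at x)"
    using v[unfolded regular_subdifferential_iff, rule_format, OF half_gt_zero[OF e]] .
  moreover have "eventually (\<lambda>y. \<bar>f y - f x - g \<bullet> (y - x)\<bar> \<le> e/2 * norm (y - x)) (at x)"
    using has_derivative_inner_approx[OF f, of "e/2"] e by (simp add: eventually_at_filter eventually_mono)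
  ultimately have "eventually (\<lambda>y. objective f r lam y - objective f r lam x - v \<bullet> (y - x) \<ge> - (e/2) * norm (y - x)
      \<and> \<bar>f y - f x - g \<bullet> (y - x)\<bar> \<le> e/2 * norm (y - x)) (at x)"
    by (rule eventually_conj)
  then obtain d where d: "d > 0" and
    dd: "\<forall>y\<in>UNIV. y \<noteq> x \<and> dist y x < d \<longrightarrow>
      objective f r lam y - objective f r lam x - v \<bullet> (y - x) \<ge> - (e/2) * norm (y - x)
      \<and> \<bar>f y - f x - g \<bullet> (y - x)\<bar> \<le> e/2 * norm (y - x)"
    unfolding eventually_at by (elim exE conjE)
  have *: "(v $ i - g $ i) * s \<le> (lam * R + e) * \<bar>s\<bar>" if "s \<noteq> 0" "\<bar>s\<bar> < d" for s
  proof -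
    define y where "y = x + axis i s"
    have yx: "y - x = axis i s" by (simp add: y_def)
    have n: "norm (y - x) = \<bar>s\<bar>" by (simp add: yx norm_eq_sqrt_inner inner_axis_axis)
    have "(\<Sum>j\<in>UNIV. r \<bar>y $ j\<bar>) - (\<Sum>j\<in>UNIV. r \<bar>x $ j\<bar>) = (\<Sum>j\<in>UNIV. r \<bar>y $ j\<bar> - r \<bar>x $ j\<bar>)"
      by (simp add: sum_subtractf)
    also have "\<dots> = (\<Sum>j\<in>UNIV. if j = i then r \<bar>s\<bar> else 0)"
      using i assms(1) by (intro sum.cong) (auto simp: y_def axis_def A1_def)
    also have "\<dots> = r \<bar>s\<bar>" by simp
    finally have "lam * (\<Sum>j\<in>UNIV. r \<bar>y $ j\<bar>) - lam * (\<Sum>j\<in>UNIV. r \<bar>x $ j\<bar>) = lam * r \<bar>s\<bar>"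
      by (simp add: right_diff_distrib[symmetric])
    moreover have "lam * r \<bar>s\<bar> \<le> lam * (R * \<bar>s\<bar>)"
      using A1_le_deriv0_linear[OF assms(1,2), of "\<bar>s\<bar>"] assms(3) by (intro mult_left_mono) auto
    moreover have "objective f r lam y - objective f r lam x =
        f y - f x + (lam * (\<Sum>j\<in>UNIV. r \<bar>y $ j\<bar>) - lam * (\<Sum>j\<in>UNIV. r \<bar>x $ j\<bar>))"
      by (simp add: objective_def)
    moreover have "y \<noteq> x" "dist y x < d" using that n by (auto simp: dist_norm)
    then have "objective f r lam y - objective f r lam x - v \<bullet> (y - x) \<ge> - (e/2) * \<bar>s\<bar>"
      "\<bar>f y - f x - g \<bullet> (y - x)\<bar> \<le> e/2 * \<bar>s\<bar>"
      using dd unfolding n[symmetric] by auto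
    moreover have "v \<bullet> (y - x) = v $ i * s" "g \<bullet> (y - x) = g $ i * s"
      by (simp_all add: yx inner_axis)
    ultimately show ?thesis
      unfolding left_diff_distrib distrib_right mult.assoc by linarith
  qed
  have "(v $ i - g $ i) * (d/2) \<le> (lam * R + e) * (d/2)"
    using *[of "d/2"] d by simp
  then have "v $ i - g $ i \<le> lam * R + e"
    by (rule mult_right_le_imp_le) (use d in simp)
  moreover have "- (v $ i - g $ i) * (d/2) \<le> (lam * R + e) * (d/2)"
  proof -
    have "\<bar>- (d/2)\<bar> = d/2" "- (d/2) \<noteq> 0" "d/2 < d" using d by simp_all
    then show ?thesis using *[of "- (d/2)"] by (metis minus_mult_commute)
  qed
  then have "- (v $ i - g $ i) \<le> lam * R + e"
    by (rule mult_right_le_imp_le) (use d in simp)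
  ultimately show "\<bar>v $ i - g $ i\<bar> \<le> lam * R + e" by linarith
qed

text \<open>The line through 0 and \<open>v\<close> lies in the affine hull of \<open>S\<close>, so
  a relative neighbourhood of 0 in \<open>S\<close> also contains points on the side opposite to
  \<open>v\<close>.\<close>

lemma rel_interior_scale_neg:
  fixes S :: "'a::euclidean_space set"
  assumes "0 \<in> rel_interior S" "v \<in> S"
  obtains d where "d > 0" "- d *\<^sub>R v \<in> S"
proof -
  obtain e where e: "e > 0" "ball 0 e \<inter> affine hull S \<subseteq> S" and S: "0 \<in> S"
    using assms(1) unfolding mem_rel_interior_ball by auto
  \<comment> \<open>The summand 1 keeps the denominator positive when \<open>v = 0\<close>.\<close>
  define d where "d = e / (2 * (norm v + 1))"
  have n: "norm v + 1 > 0" using norm_ge_zero[of v] by linarith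
  have d: "d > 0" using e n by (simp add: d_def)
  have "d * norm v \<le> d * (norm v + 1)" using d by simp
  also have "\<dots> = e / 2" using n by (simp add: d_def field_simps)
  also have "\<dots> < e" using e by simp
  finally have "d * norm v < e" .
  then have "- d *\<^sub>R v \<in> ball 0 e" using d by simp
  moreover have "- d *\<^sub>R v \<in> affine hull S"
  proof -
    have "(1 + d) *\<^sub>R 0 + (- d) *\<^sub>R v \<in> affine hull S"
      by (intro mem_affine affine_affine_hull hull_inc S assms) simp
    then show ?thesis by simp
  qed
  ultimately show ?thesis using e d that by blast
qed

text \<open>The point \<open>axis i (g $ i)\<close> is a subgradient, so some negative multiple of it is one as well;
  the necessary condition at that multiple leaves room in the \<open>i\<close>-th bound.\<close>

lemma A2_strict_bound:
  fixes f :: "real ^ 'n \<Rightarrow> real"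
  assumes "A1 r" "deriv0 r = ereal R" "lam > 0" and A2: "A2 (objective f r lam)"
    and f: "(f has_derivative (\<lambda>h. h \<bullet> g)) (at x)"
    and nz: "\<And>i. x $ i \<noteq> 0 \<Longrightarrow> g $ i = - lam * sgn (x $ i) * deriv r \<bar>x $ i\<bar>"
    and z: "\<And>i. x $ i = 0 \<Longrightarrow> \<bar>g $ i\<bar> \<le> lam * R"
    and i: "x $ i = 0"
  shows "\<bar>g $ i\<bar> < lam * R"
proof -
  let ?S = "regular_subdifferential (objective f r lam) x"
  have R: "R > 0" using assms by (simp add: A1_def)
  have "0 \<in> ?S"
    using nz z by (intro mem_regular_subdifferential_objective[OF assms(1-3) f]) auto
  then have "0 \<in> rel_interior ?S" using A2 by (simp add: A2_def)
  \<comment> \<open>For \<open>v = axis i (g $ i)\<close> the \<open>i\<close>-th coordinate of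
    \<open>v - g\<close> vanishes, and the others are the same as for \<open>v = 0\<close>.\<close>
  moreover have "axis i (g $ i) \<in> ?S"
    using nz z i R \<open>lam > 0\<close>
    by (intro mem_regular_subdifferential_objective[OF assms(1-3) f]) (auto simp: axis_def)
  ultimately obtain d where d: "d > 0" "- d *\<^sub>R axis i (g $ i) \<in> ?S"
    by (rule rel_interior_scale_neg)
  have "\<bar>- d * g $ i - g $ i\<bar> \<le> lam * R"
    using regular_subdifferential_objective_bound[OF assms(1-3) f d(2) i] by simp
  also have "- d * g $ i - g $ i = - ((1 + d) * g $ i)" by (simp add: algebra_simps)
  finally have "(1 + d) * \<bar>g $ i\<bar> \<le> lam * R" using d by (simp add: abs_mult)
  moreover have "0 < d * \<bar>g $ i\<bar>" if "g $ i \<noteq> 0" using d that by simp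
  moreover have "0 < lam * R" using R assms by simp
  ultimately show ?thesis by (cases "g $ i = 0") (auto simp: distrib_right)
qed

section \<open>The subproblem\<close>

lemma weighted_l1_convex:
  fixes w x y :: "real ^ 'n"
  assumes "\<And>i. w $ i \<ge> 0" "0 \<le> t" "t \<le> 1"
  shows "(\<Sum>i\<in>UNIV. w $ i * \<bar>(x + t *\<^sub>R (y - x)) $ i\<bar>) \<le>
    (1 - t) * (\<Sum>i\<in>UNIV. w $ i * \<bar>x $ i\<bar>) + t * (\<Sum>i\<in>UNIV. w $ i * \<bar>y $ i\<bar>)"
proof -
  have "w $ i * \<bar>(x + t *\<^sub>R (y - x)) $ i\<bar> \<le> (1 - t) * (w $ i * \<bar>x $ i\<bar>) + t * (w $ i * \<bar>y $ i\<bar>)" for i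
  proof -
    have "\<bar>(x + t *\<^sub>R (y - x)) $ i\<bar> = \<bar>(1 - t) * x $ i + t * y $ i\<bar>" by (simp add: algebra_simps)
    also have "\<dots> \<le> (1 - t) * \<bar>x $ i\<bar> + t * \<bar>y $ i\<bar>"
      using assms abs_triangle_ineq[of "(1 - t) * x $ i" "t * y $ i"] by (simp add: abs_mult)
    finally have "w $ i * \<bar>(x + t *\<^sub>R (y - x)) $ i\<bar> \<le> w $ i * \<dots>"
      using assms by (intro mult_left_mono) auto
    then show ?thesis by (simp add: algebra_simps)
  qed
  then show ?thesis
    by (simp add: sum_distrib_left sum.distrib[symmetric] sum_mono)
qed

text \<open>Plain comparison of \<open>y\<close> with \<open>x\<close> would only give the
  coefficient \<open>beta / 2\<close>. The strong convexity of the model doubles it: compare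
  \<open>y\<close> with a point of the segment from \<open>x\<close> to \<open>y\<close>, divide by
  \<open>1 - s\<close> and let \<open>s\<close> tend to 1.\<close>

lemma subproblem_decrease:
  fixes f :: "real ^ 'n \<Rightarrow> real"
  assumes y: "is_arg_min (subproblem f lam beta x w) (\<lambda>_. True) y"
    and w: "\<And>i. w $ i \<ge> 0" and lam: "lam > 0"
  shows "grad f x \<bullet> (y - x) + beta * (norm (y - x))\<^sup>2
      + lam * ((\<Sum>i\<in>UNIV. w $ i * \<bar>y $ i\<bar>) - (\<Sum>i\<in>UNIV. w $ i * \<bar>x $ i\<bar>)) \<le> 0"
    (is "?A + beta * ?N + lam * (?P y - ?P x) \<le> 0")
proof -
  have *: "?A + beta / 2 * (1 + s) * ?N + lam * (?P y - ?P x) \<le> 0" if "0 < s" "s < 1" for s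
  proof -
    define z where "z = x + s *\<^sub>R (y - x)"
    have zx: "z - x = s *\<^sub>R (y - x)" by (simp add: z_def)
    have "subproblem f lam beta x w y \<le> subproblem f lam beta x w z"
      using y by (simp add: is_arg_min_def not_less)
    moreover have "subproblem f lam beta x w z = s * ?A + beta / 2 * (s\<^sup>2 * ?N) + lam * ?P z"
      using that by (simp add: subproblem_def zx power_mult_distrib)
    moreover have "lam * ?P z \<le> lam * ((1 - s) * ?P x + s * ?P y)"
      using that w lam unfolding z_def by (intro mult_left_mono weighted_l1_convex) auto
    moreover have "subproblem f lam beta x w y = ?A + beta / 2 * ?N + lam * ?P y"
      by (simp add: subproblem_def)
    \<comment> \<open>The factor \<open>1 - s\<close> splits off because
      \<open>1 - s\<^sup>2 = (1 - s) * (1 + s)\<close>.\<close>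
    moreover have "(1 - s) * (a + beta / 2 * (1 + s) * n + lam * (p - q)) =
        (a + beta / 2 * n + lam * p) - (s * a + beta / 2 * (s\<^sup>2 * n) + lam * ((1 - s) * q + s * p))"
      for a n p q by (simp add: field_simps power2_eq_square)
    note this[of ?A ?N "?P y" "?P x"]
    ultimately have "(1 - s) * (?A + beta / 2 * (1 + s) * ?N + lam * (?P y - ?P x)) \<le> 0"
      by linarith
    then show ?thesis using that by (simp add: mult_le_0_iff)
  qed
  have "((\<lambda>s. ?A + beta / 2 * (1 + s) * ?N + lam * (?P y - ?P x)) \<longlongrightarrow>
      ?A + beta / 2 * (1 + 1) * ?N + lam * (?P y - ?P x)) (at_left 1)"
    by (intro tendsto_intros)
  moreover have "eventually (\<lambda>s. ?A + beta / 2 * (1 + s) * ?N + lam * (?P y - ?P x) \<le> 0) (at_left 1)"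
    unfolding eventually_at_left_field using * by (intro exI[of _ 0]) auto
  ultimately have "?A + beta / 2 * (1 + 1) * ?N + lam * (?P y - ?P x) \<le> 0"
    using tendsto_upperbound trivial_limit_at_left_real by blast
  then show ?thesis by simp
qed

text \<open>If \<open>\<bar>g\<bar> > c\<close>, a suitable step against the sign of
  \<open>g\<close> makes the expression negative. This is the part of the optimality condition that
  holds whether or not \<open>u\<close> vanishes.\<close>

lemma quadratic_abs_min_bound:
  fixes g b c u :: real
  assumes "\<And>t. g * t + b / 2 * t\<^sup>2 + c * (\<bar>u + t\<bar> - \<bar>u\<bar>) \<ge> 0" "c \<ge> 0" "b > 0"
  shows "\<bar>g\<bar> \<le> c"
proof (rule ccontr)
  assume "\<not> \<bar>g\<bar> \<le> c"
  \<comment> \<open>The minimizer of \<open>b / 2 * s\<^sup>2 - (\<bar>g\<bar> - c) * s\<close>,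
    which bounds the expression at \<open>t\<close> from above.\<close>
  define s where "s = (\<bar>g\<bar> - c) / b"
  have s: "s > 0" using \<open>\<not> \<bar>g\<bar> \<le> c\<close> assms by (simp add: s_def)
  define t where "t = - sgn g * s"
  have g0: "g \<noteq> 0" using \<open>\<not> \<bar>g\<bar> \<le> c\<close> assms by auto
  have "g * t = - \<bar>g\<bar> * s" by (simp add: t_def abs_sgn)
  moreover have "t\<^sup>2 = s\<^sup>2" using g0 by (simp add: t_def power_mult_distrib sgn_if)
  moreover have "\<bar>t\<bar> = s" using g0 s by (simp add: t_def abs_mult sgn_if)
  then have "c * (\<bar>u + t\<bar> - \<bar>u\<bar>) \<le> c * s" using assms by (intro mult_left_mono) auto
  ultimately have "0 \<le> s * (b / 2 * s - (\<bar>g\<bar> - c))"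
    using assms(1)[of t] by (simp add: algebra_simps power2_eq_square)
  then have "0 \<le> b / 2 * s - (\<bar>g\<bar> - c)" using s by (simp add: zero_le_mult_iff)
  moreover have "b * s = \<bar>g\<bar> - c" using assms by (simp add: s_def)
  ultimately show False using \<open>\<not> \<bar>g\<bar> \<le> c\<close> by simp
qed

text \<open>For \<open>u \<noteq> 0\<close> the expression is differentiable at
  \<open>t = 0\<close>, where it attains its minimum 0.\<close>

lemma quadratic_abs_min_eq:
  fixes g b c u :: real
  assumes "\<And>t. g * t + b / 2 * t\<^sup>2 + c * (\<bar>u + t\<bar> - \<bar>u\<bar>) \<ge> 0" "u \<noteq> 0" "b > 0"
  shows "g = - c * sgn u"
proof -
  define h where "h t = g * t + b / 2 * t\<^sup>2 + c * (\<bar>u + t\<bar> - \<bar>u\<bar>)" for t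
  have "((\<lambda>t. \<bar>u + t\<bar>) has_real_derivative sgn u) (at 0)"
  proof -
    have "((\<lambda>s. \<bar>s\<bar>) has_real_derivative sgn u) (at (u + 0))"
      using has_real_derivative_abs[OF \<open>u \<noteq> 0\<close>] by simp
    moreover have "((\<lambda>t. u + t) has_real_derivative 1) (at 0)"
      by (auto intro!: derivative_eq_intros)
    ultimately show ?thesis
      using DERIV_chain2[where f = abs and g = "\<lambda>t. u + t" and x = 0] by fastforce
  qed
  then have "(h has_real_derivative g + c * sgn u) (at 0)"
    unfolding h_def by (auto intro!: derivative_eq_intros)
  moreover have "\<forall>t. \<bar>0 - t\<bar> < 1 \<longrightarrow> h 0 \<le> h t" using assms(1) by (simp add: h_def)
  ultimately have "g + c * sgn u = 0"
    using DERIV_local_min[of h _ 0 1] by simp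
  then show ?thesis by simp
qed

text \<open>Perturbing the minimizer along one axis leaves a scalar problem of the form handled by
  the two preceding lemmas.\<close>

lemma subproblem_coordinate:
  fixes f :: "real ^ 'n \<Rightarrow> real"
  assumes y: "is_arg_min (subproblem f lam beta x w) (\<lambda>_. True) y"
  shows "(grad f x $ i + beta * (y $ i - x $ i)) * t + beta / 2 * t\<^sup>2
    + lam * w $ i * (\<bar>y $ i + t\<bar> - \<bar>y $ i\<bar>) \<ge> 0"
proof -
  define z where "z = y + axis i t"
  have "(\<Sum>j\<in>UNIV. w $ j * \<bar>z $ j\<bar>) - (\<Sum>j\<in>UNIV. w $ j * \<bar>y $ j\<bar>) =
      (\<Sum>j\<in>UNIV. w $ j * (\<bar>z $ j\<bar> - \<bar>y $ j\<bar>))"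
    by (simp add: sum_subtractf right_diff_distrib)
  also have "\<dots> = (\<Sum>j\<in>UNIV. if j = i then w $ i * (\<bar>y $ i + t\<bar> - \<bar>y $ i\<bar>) else 0)"
    by (intro sum.cong) (auto simp: z_def axis_def)
  also have "\<dots> = w $ i * (\<bar>y $ i + t\<bar> - \<bar>y $ i\<bar>)" by simp
  finally have P: "lam * (\<Sum>j\<in>UNIV. w $ j * \<bar>z $ j\<bar>) - lam * (\<Sum>j\<in>UNIV. w $ j * \<bar>y $ j\<bar>) =
      lam * w $ i * (\<bar>y $ i + t\<bar> - \<bar>y $ i\<bar>)"
    by (simp add: right_diff_distrib[symmetric])
  have zx: "z - x = (y - x) + axis i t" by (simp add: z_def)
  have N: "(norm (z - x))\<^sup>2 = (norm (y - x))\<^sup>2 + 2 * t * (y $ i - x $ i) + t\<^sup>2"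
    unfolding zx power2_norm_eq_inner
    by (simp add: inner_add_left inner_add_right inner_axis inner_axis' power2_eq_square algebra_simps)
  have G: "grad f x \<bullet> (z - x) = grad f x \<bullet> (y - x) + grad f x $ i * t"
    unfolding zx by (simp add: inner_add_right inner_axis)
  have "subproblem f lam beta x w y \<le> subproblem f lam beta x w z"
    using y by (simp add: is_arg_min_def not_less)
  then show ?thesis
    unfolding subproblem_def N G using P by (simp add: algebra_simps)
qed

section \<open>Sufficient decrease\<close>

text \<open>The derivative bound is only available where \<open>\<phi> \<le> 0\<close>; it propagates up to \<open>a\<close> because at
  the first positive zero of \<open>\<phi>\<close> it would give \<open>\<phi> < 0\<close>.\<close>

lemma descent_first_exit:
  fixes \<phi> \<phi>' :: "real \<Rightarrow> real"
  assumes der: "\<And>t. (\<phi> has_real_derivative \<phi>' t) (at t)" and \<phi>0: "\<phi> 0 = 0"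
    and bound: "\<And>t. 0 \<le> t \<Longrightarrow> t \<le> a \<Longrightarrow> \<phi> t \<le> 0 \<Longrightarrow> \<phi>' t \<le> (L * t - b) * D"
    and D: "D > 0" and a: "a > 0" and b: "b > a * L / 2" "b > 0"
  shows "\<phi> a \<le> - (a * (b - a * L / 2)) * D"
proof -
  have decr: "\<phi> t \<le> - (t * (b - t * L / 2)) * D"
    if t: "0 \<le> t" "t \<le> a" and neg: "\<And>s. 0 \<le> s \<Longrightarrow> s < t \<Longrightarrow> \<phi> s \<le> 0" for t
  proof -
    \<comment> \<open>Subtracts from \<open>\<phi>\<close> the antiderivative of the bound on
      \<open>\<phi>'\<close>, so \<open>\<psi>\<close> does not increase while
      \<open>\<phi> \<le> 0\<close>.\<close>
    define \<psi> where "\<psi> t = \<phi> t + (t * b - t\<^sup>2 * L / 2) * D" for t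
    have \<psi>: "(\<psi> has_real_derivative \<phi>' t - (L * t - b) * D) (at t)" for t
      unfolding \<psi>_def by (auto intro!: derivative_eq_intros der simp: algebra_simps)
    have "\<psi> t \<le> \<psi> 0"
    proof (rule DERIV_nonpos_imp_decreasing_open[OF t(1)])
      show "\<exists>y. (\<psi> has_real_derivative y) (at s) \<and> y \<le> 0" if "0 < s" "s < t" for s
        using \<psi>[of s] bound[of s] neg[of s] that t by fastforce
      show "continuous_on {0..t} \<psi>"
        by (intro continuous_at_imp_continuous_on ballI DERIV_isCont[OF \<psi>])
    qed
    then show ?thesis
      by (simp add: \<psi>_def \<phi>0 algebra_simps power2_eq_square)
  qed
  have pos: "t * (b - t * L / 2) > 0" if "0 < t" "t \<le> a" for t
  proof -
    \<comment> \<open>\<open>L\<close> may be negative: then \<open>b > 0\<close> suffices,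
      otherwise the bound at \<open>a\<close> does.\<close>
    have "t * L / 2 < b"
    proof (cases "L \<ge> 0")
      case True
      then have "t * L \<le> a * L" using that by (intro mult_right_mono) auto
      then show ?thesis using b by simp
    next
      case False
      then have "t * L < 0" using that by (intro mult_pos_neg) auto
      then show ?thesis using b by simp
    qed
    then show ?thesis using that by simp
  qed
  have "\<phi>' 0 < 0" using bound[of 0] a \<phi>0 D b by (smt (verit) mult_pos_pos mult_zero_right mult_minus_left)
  then obtain d where d: "d > 0" "\<And>h. 0 < h \<Longrightarrow> h < d \<Longrightarrow> \<phi> h < 0"
    using DERIV_neg_dec_right[OF der[of 0]] \<phi>0 by auto
  have "\<phi> t \<le> 0" if t: "0 \<le> t" "t \<le> a" for t
  proof (rule ccontr)
    assume "\<not> \<phi> t \<le> 0"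
    \<comment> \<open>Starting at \<open>d/2\<close> excludes the trivial zero at 0; since
      \<open>\<phi>\<close> is negative on the open interval from 0 to \<open>d\<close>, the least
      element of \<open>Z\<close> is the first positive zero.\<close>
    define Z where "Z = {s \<in> {d/2..t}. \<phi> s = 0}"
    have d_le: "d \<le> s" if "0 \<le> s" "\<not> \<phi> s \<le> 0" for s
      using that d(2)[of s] \<phi>0 by (metis less_eq_real_def not_le)
    have tpos: "d \<le> t" using t(1) \<open>\<not> \<phi> t \<le> 0\<close> by (rule d_le)
    have cont: "continuous_on S \<phi>" for S
      by (intro continuous_at_imp_continuous_on ballI DERIV_isCont[OF der])
    have "\<phi> (d/2) < 0" using d by simp
    have "\<exists>s\<ge>d/2. s \<le> t \<and> \<phi> s = 0"
      using \<open>\<phi> (d/2) < 0\<close> \<open>\<not> \<phi> t \<le> 0\<close> d(1) tpos by (intro IVT' cont) auto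
    then have "Z \<noteq> {}" by (auto simp: Z_def)
    moreover have "compact Z"
    proof -
      have "closed Z"
        unfolding Z_def by (intro continuous_closed_preimage_constant cont) auto
      moreover have "bounded Z"
        by (rule bounded_subset[of "{d/2..t}"]) (auto simp: Z_def)
      ultimately show ?thesis by (simp add: compact_eq_bounded_closed)
    qed
    ultimately obtain m where m: "m \<in> Z" "\<And>s. s \<in> Z \<Longrightarrow> m \<le> s"
      using compact_attains_inf by metis
    have "\<phi> s \<le> 0" if s: "0 \<le> s" "s < m" for s
    proof (rule ccontr)
      assume "\<not> \<phi> s \<le> 0"
      with s(1) have "d \<le> s" by (rule d_le)
      then have "\<exists>q\<ge>d/2. q \<le> s \<and> \<phi> q = 0"
        using \<open>\<phi> (d/2) < 0\<close> \<open>\<not> \<phi> s \<le> 0\<close> d(1) \<open>d \<le> s\<close> by (intro IVT' cont) auto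
      then obtain q where "q \<in> Z" "q \<le> s" using s m(1) by (auto simp: Z_def)
      then show False using m(2) s by fastforce
    qed
    moreover have "0 < m" "m \<le> a" "\<phi> m = 0" using m(1) t d by (auto simp: Z_def)
    ultimately have "0 \<le> - (m * (b - m * L / 2)) * D" using decr[of m] by simp
    moreover have "0 < m * (b - m * L / 2) * D"
      by (rule mult_pos_pos[OF pos[OF \<open>0 < m\<close> \<open>m \<le> a\<close>] D])
    ultimately show False unfolding mult_minus_left by linarith
  qed
  then show ?thesis using a by (intro decr) auto
qed

text \<open>Links the quantity that decreases, the smoothed objective, to the level set on which the
  gradient is Lipschitz.\<close>

lemma objective_le_smoothed:
  assumes "A1 r" "lam > 0" "\<And>i. e $ i \<ge> 0"
  shows "objective f r lam x \<le> smoothed_objective f r lam x e"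
  unfolding objective_def smoothed_objective_def
  using assms by (auto intro!: mult_left_mono sum_mono A1_mono[OF assms(1)])

lemma smoothed_objective_mono:
  assumes "A1 r" "lam > 0" "\<And>i. 0 \<le> e $ i" "\<And>i. e $ i \<le> e' $ i"
  shows "smoothed_objective f r lam x e \<le> smoothed_objective f r lam x e'"
  unfolding smoothed_objective_def
  using assms by (auto intro!: mult_left_mono sum_mono A1_mono[OF assms(1)])

text \<open>The weight \<open>w $ i\<close> is the slope of the tangent to \<open>r\<close> at
  \<open>\<bar>x $ i\<bar> + e $ i\<close>, and \<open>e $ i\<close> cancels from the increment.
  Convexity of the weighted l1 norm then bounds the resulting increment along the segment linearly
  in \<open>t\<close>.\<close>

lemma smoothed_objective_majorant:
  fixes x y e :: "real ^ 'n"
  assumes "A1 r" "lam > 0" and e: "\<And>i. e $ i > 0" and t: "0 \<le> t" "t \<le> 1"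
    and w: "\<And>i. w $ i = deriv r (\<bar>x $ i\<bar> + e $ i)"
  shows "smoothed_objective f r lam (x + t *\<^sub>R (y - x)) e \<le> smoothed_objective f r lam x e
    + (f (x + t *\<^sub>R (y - x)) - f x)
    + t * lam * ((\<Sum>i\<in>UNIV. w $ i * \<bar>y $ i\<bar>) - (\<Sum>i\<in>UNIV. w $ i * \<bar>x $ i\<bar>))"
proof -
  let ?z = "x + t *\<^sub>R (y - x)"
  have w0: "w $ i \<ge> 0" for i
    using A1_deriv(3)[OF assms(1)] e[of i] w by (simp add: add_nonneg_pos)
  have "r (\<bar>?z $ i\<bar> + e $ i) \<le> r (\<bar>x $ i\<bar> + e $ i) + w $ i * (\<bar>?z $ i\<bar> - \<bar>x $ i\<bar>)" for i
    using A1_tangent[OF assms(1), of "\<bar>x $ i\<bar> + e $ i" "\<bar>?z $ i\<bar> + e $ i"] e[of i] w by simp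
  then have "(\<Sum>i\<in>UNIV. r (\<bar>?z $ i\<bar> + e $ i)) \<le>
      (\<Sum>i\<in>UNIV. r (\<bar>x $ i\<bar> + e $ i) + w $ i * (\<bar>?z $ i\<bar> - \<bar>x $ i\<bar>))"
    by (intro sum_mono)
  also have "\<dots> = (\<Sum>i\<in>UNIV. r (\<bar>x $ i\<bar> + e $ i)) +
      ((\<Sum>i\<in>UNIV. w $ i * \<bar>?z $ i\<bar>) - (\<Sum>i\<in>UNIV. w $ i * \<bar>x $ i\<bar>))"
    by (simp add: sum.distrib right_diff_distrib sum_subtractf)
  also have "\<dots> \<le> (\<Sum>i\<in>UNIV. r (\<bar>x $ i\<bar> + e $ i)) +
      t * ((\<Sum>i\<in>UNIV. w $ i * \<bar>y $ i\<bar>) - (\<Sum>i\<in>UNIV. w $ i * \<bar>x $ i\<bar>))"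
    using weighted_l1_convex[of w t x y, OF w0 t] by (simp add: algebra_simps)
  finally have "lam * (\<Sum>i\<in>UNIV. r (\<bar>?z $ i\<bar> + e $ i)) \<le> lam * \<dots>"
    using assms(2) by (intro mult_left_mono) auto
  then show ?thesis
    unfolding smoothed_objective_def by (simp add: algebra_simps)
qed

text \<open>An upper bound \<open>\<phi>\<close> for the change of the smoothed objective along the
  segment is fed to \<open>descent_first_exit\<close>: wherever \<open>\<phi> \<le> 0\<close>, the
  point lies in the level set, so the Lipschitz condition applies and controls
  \<open>\<phi>'\<close>.\<close>

lemma DIRL1_step_decrease:
  fixes f :: "real ^ 'n \<Rightarrow> real" and x y e w :: "real ^ 'n"
  assumes A1: "A1 r" and lam: "lam > 0"
    and f: "\<And>x. (f has_derivative (\<lambda>h. h \<bullet> grad f x)) (at x)"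
    and L: "\<forall>x y. objective f r lam x \<le> F0 \<longrightarrow> objective f r lam y \<le> F0 \<longrightarrow>
              norm (grad f x - grad f y) \<le> L * norm (x - y)"
    and alpha: "0 < alpha" "alpha < 1" and beta: "beta > alpha * L / 2" "beta > 0"
    and e: "\<And>i. e $ i > 0"
    and w: "\<And>i. w $ i = deriv r (\<bar>x $ i\<bar> + e $ i)"
    and y: "is_arg_min (subproblem f lam beta x w) (\<lambda>_. True) y"
    and F0: "smoothed_objective f r lam x e \<le> F0"
  shows "smoothed_objective f r lam (x + alpha *\<^sub>R (y - x)) e \<le>
    smoothed_objective f r lam x e - alpha * (beta - alpha * L / 2) * (norm (y - x))\<^sup>2"
proof (cases "y = x")
  case False
  define d where "d = y - x"
  define D where "D = (norm d)\<^sup>2"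
  have D: "D > 0" using False by (simp add: D_def d_def)
  \<comment> \<open>The change of \<open>f\<close> is kept exact; the last two terms replace the
    change of the weighted norm by means of \<open>subproblem_decrease\<close>.\<close>
  define \<phi> where "\<phi> t = f (x + t *\<^sub>R d) - f x - t * (grad f x \<bullet> d) - t * beta * D" for t
  define \<phi>' where "\<phi>' t = (grad f (x + t *\<^sub>R d) - grad f x) \<bullet> d - beta * D" for t
  have w0: "w $ i \<ge> 0" for i
    using A1_deriv(3)[OF A1] e[of i] w by (simp add: add_nonneg_pos)
  have maj: "smoothed_objective f r lam (x + t *\<^sub>R d) e \<le> smoothed_objective f r lam x e + \<phi> t"
    if t: "0 \<le> t" "t \<le> 1" for t
  proof -
    let ?P = "(\<Sum>i\<in>UNIV. w $ i * \<bar>y $ i\<bar>) - (\<Sum>i\<in>UNIV. w $ i * \<bar>x $ i\<bar>)"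
    have "t * (grad f x \<bullet> d + beta * D + lam * ?P) \<le> 0"
      using subproblem_decrease[OF y w0 lam] t unfolding d_def D_def by (simp add: mult_nonneg_nonpos)
    moreover note smoothed_objective_majorant[where f = f and w = w and y = y, OF A1 lam e t w]
    ultimately show ?thesis unfolding \<phi>_def d_def[symmetric] by (simp add: algebra_simps)
  qed
  have "\<phi> alpha \<le> - (alpha * (beta - alpha * L / 2)) * D"
  proof (rule descent_first_exit[OF _ _ _ D alpha(1) beta])
    show "(\<phi> has_real_derivative \<phi>' t) (at t)" for t
    proof -
      have "((\<lambda>t. x + t *\<^sub>R d) has_derivative (\<lambda>h. h *\<^sub>R d)) (at t)"
        by (auto intro!: derivative_eq_intros)
      from has_derivative_compose[OF this f]
      have "((\<lambda>t. f (x + t *\<^sub>R d)) has_real_derivative grad f (x + t *\<^sub>R d) \<bullet> d) (at t)"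
        by (simp add: has_field_derivative_def inner_commute[of _ d] mult.commute[of _ "d \<bullet> _"])
      then show ?thesis unfolding \<phi>_def \<phi>'_def
        by (auto intro!: derivative_eq_intros simp: inner_diff_left)
    qed
    show "\<phi> 0 = 0" by (simp add: \<phi>_def)
    show "\<phi>' t \<le> (L * t - beta) * D" if "0 \<le> t" "t \<le> alpha" "\<phi> t \<le> 0" for t
    proof -
      have "objective f r lam (x + t *\<^sub>R d) \<le> F0"
        using objective_le_smoothed[OF A1 lam, of e f "x + t *\<^sub>R d"] e maj[of t] that alpha F0
        by (smt (verit))
      moreover have "objective f r lam x \<le> F0"
        using objective_le_smoothed[OF A1 lam, of e f x] e F0 by (smt (verit))
      ultimately have "norm (grad f (x + t *\<^sub>R d) - grad f x) \<le> L * norm (x + t *\<^sub>R d - x)"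
        using L by blast
      then have "norm (grad f (x + t *\<^sub>R d) - grad f x) * norm d \<le> L * (t * norm d) * norm d"
        using that by (intro mult_right_mono) auto
      then have "(grad f (x + t *\<^sub>R d) - grad f x) \<bullet> d \<le> L * t * D"
        using norm_cauchy_schwarz[of "grad f (x + t *\<^sub>R d) - grad f x" d]
        by (simp add: D_def power2_eq_square mult.assoc)
      then show ?thesis by (simp add: \<phi>'_def left_diff_distrib)
    qed
  qed
  with maj[of alpha] alpha show ?thesis by (simp add: D_def d_def)
qed simp

section \<open>Convergence\<close>

lemma DIRL1_smoothing:
  fixes es :: "nat \<Rightarrow> real ^ 'n"
  assumes "\<And>k. es (Suc k) = q *\<^sub>R es k" "0 < q" "q < 1" "\<And>i. es 0 $ i > 0"
  shows "es k $ i > 0" "es (Suc k) $ i \<le> es k $ i" "es \<longlonglongrightarrow> 0"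
proof -
  show pos: "es k $ i > 0" for k using assms by (induction k) auto
  show "es (Suc k) $ i \<le> es k $ i"
    using assms pos[of k] by simp
  have eq: "es k = q ^ k *\<^sub>R es 0" for k using assms by (induction k) auto
  have "(\<lambda>k. q ^ k *\<^sub>R es 0) \<longlonglongrightarrow> 0 *\<^sub>R es 0"
    using assms by (intro tendsto_intros LIMSEQ_power_zero) auto
  then show "es \<longlonglongrightarrow> 0" by (simp add: eq[symmetric])
qed

text \<open>\<open>G k\<close> is the derivative of the smooth part of the subproblem at its
  minimizer and tends to \<open>grad f x $ i\<close>, because \<open>Y k - X k\<close> vanishes in
  the limit. Where \<open>x $ i \<noteq> 0\<close> the weights converge and the optimality equation
  survives; where \<open>x $ i = 0\<close> the signs of \<open>Y k $ i\<close> need not settle, and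
  only the bound by \<open>R\<close> is kept.\<close>

lemma limit_first_order_conditions:
  fixes f :: "real ^ 'n \<Rightarrow> real" and X Y W E :: "nat \<Rightarrow> real ^ 'n"
  assumes A1: "A1 r" and lam: "lam > 0" and beta: "beta > 0"
    and grad: "continuous_on UNIV (grad f)"
    and W: "\<And>k i. W k $ i = deriv r (\<bar>X k $ i\<bar> + E k $ i)"
    and E: "\<And>k i. E k $ i > 0"
    and Y: "\<And>k. is_arg_min (subproblem f lam beta (X k) (W k)) (\<lambda>_. True) (Y k)"
    and limX: "X \<longlonglongrightarrow> x" and limE: "E \<longlonglongrightarrow> 0" and limY: "(\<lambda>k. Y k - X k) \<longlonglongrightarrow> 0"
  shows "x $ i \<noteq> 0 \<Longrightarrow> grad f x $ i = - lam * sgn (x $ i) * deriv r \<bar>x $ i\<bar>"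
    and "deriv0 r = ereal R \<Longrightarrow> \<bar>grad f x $ i\<bar> \<le> lam * R"
proof -
  define G where "G k = grad f (X k) $ i + beta * (Y k $ i - X k $ i)" for k
  have "(\<lambda>k. grad f (X k) $ i + beta * (Y k - X k) $ i) \<longlonglongrightarrow> grad f x $ i + beta * 0 $ i"
    by (intro tendsto_intros limY continuous_on_tendsto_compose[OF grad limX]) auto
  then have G: "G \<longlonglongrightarrow> grad f x $ i" by (simp add: G_def[abs_def])
  have arg: "(\<lambda>k. \<bar>X k $ i\<bar> + E k $ i) \<longlonglongrightarrow> \<bar>x $ i\<bar> + 0 $ i"
    by (intro tendsto_intros limX limE)
  have pos: "\<bar>X k $ i\<bar> + E k $ i > 0" for k using E[of k i] by simp
  have W0: "W k $ i \<ge> 0" for k using A1_deriv(3)[OF A1 pos] by (simp add: W)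
  have opt: "G k * t + beta / 2 * t\<^sup>2 + lam * W k $ i * (\<bar>Y k $ i + t\<bar> - \<bar>Y k $ i\<bar>) \<ge> 0" for k t
    unfolding G_def by (rule subproblem_coordinate[OF Y])
  show "grad f x $ i = - lam * sgn (x $ i) * deriv r \<bar>x $ i\<bar>" if nz: "x $ i \<noteq> 0"
  proof -
    have "(\<lambda>k. (Y k - X k) $ i + X k $ i) \<longlonglongrightarrow> 0 $ i + x $ i"
      by (intro tendsto_intros limX limY)
    then have Yi: "(\<lambda>k. Y k $ i) \<longlonglongrightarrow> x $ i" by simp
    have "isCont (deriv r) (\<bar>x $ i\<bar>)" using nz by (intro A1_deriv[OF A1]) auto
    then have "(\<lambda>k. deriv r (\<bar>X k $ i\<bar> + E k $ i)) \<longlonglongrightarrow> deriv r \<bar>x $ i\<bar>"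
      using arg by (intro isCont_tendsto_compose[of _ "deriv r"]) auto
    then have "(\<lambda>k. - lam * sgn (Y k $ i) * W k $ i) \<longlonglongrightarrow> - lam * sgn (x $ i) * deriv r \<bar>x $ i\<bar>"
      unfolding W by (intro tendsto_intros Yi nz)
    moreover have "eventually (\<lambda>k. - lam * sgn (Y k $ i) * W k $ i = G k) sequentially"
      using tendsto_imp_eventually_ne[OF Yi nz]
      by eventually_elim (use quadratic_abs_min_eq[OF opt] beta in auto)
    ultimately have "G \<longlonglongrightarrow> - lam * sgn (x $ i) * deriv r \<bar>x $ i\<bar>"
      using Lim_transform_eventually by blast
    then show ?thesis using G LIMSEQ_unique by blast
  qed
  show "\<bar>grad f x $ i\<bar> \<le> lam * R" if R: "deriv0 r = ereal R"
  proof (rule LIMSEQ_le_const2)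
    show "(\<lambda>k. \<bar>G k\<bar>) \<longlonglongrightarrow> \<bar>grad f x $ i\<bar>" by (intro tendsto_intros G)
    have "\<bar>G k\<bar> \<le> lam * R" for k
    proof -
      have "\<bar>G k\<bar> \<le> lam * W k $ i"
        using quadratic_abs_min_bound[OF opt _ beta] W0 lam by simp
      also have "W k $ i \<le> R"
        using A1_deriv_le_deriv0[OF A1 pos] by (simp add: R W)
      finally show ?thesis using lam by simp
    qed
    then show "\<exists>N. \<forall>k\<ge>N. \<bar>G k\<bar> \<le> lam * R" by blast
  qed
qed

text \<open>A decreasing sequence bounded below converges, so its consecutive differences, which
  dominate \<open>c * (norm (d k))\<^sup>2\<close>, tend to 0.\<close>

lemma sufficient_decrease_tendsto_0:
  fixes E :: "nat \<Rightarrow> real" and d :: "nat \<Rightarrow> 'a::real_normed_vector"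
  assumes dec: "\<And>k. E (Suc k) \<le> E k - c * (norm (d k))\<^sup>2" and c: "c > 0" and B: "\<And>k. B \<le> E k"
  shows "d \<longlonglongrightarrow> 0"
proof -
  have "decseq E"
  proof (rule decseq_SucI)
    fix k
    have "0 \<le> c * (norm (d k))\<^sup>2" using c by simp
    then show "E (Suc k) \<le> E k" using dec[of k] by linarith
  qed
  then obtain l where l: "E \<longlonglongrightarrow> l" using B decseq_convergent[of E B] by blast
  have "(\<lambda>k. (E k - E (Suc k)) / c) \<longlonglongrightarrow> (l - l) / c"
    using c by (intro tendsto_intros l LIMSEQ_Suc[OF l]) auto
  then have "(\<lambda>k. (E k - E (Suc k)) / c) \<longlonglongrightarrow> 0" by simp
  moreover have "norm ((norm (d k))\<^sup>2) \<le> (E k - E (Suc k)) / c" for k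
    using dec[of k] c by (simp add: field_simps)
  ultimately have "(\<lambda>k. (norm (d k))\<^sup>2) \<longlonglongrightarrow> 0"
    by (rule Lim_null_comparison[OF always_eventually[OF allI], rotated])
  from tendsto_real_sqrt[OF this] have "(\<lambda>k. norm (d k)) \<longlonglongrightarrow> 0" by simp
  then show ?thesis by (rule tendsto_norm_zero_cancel)
qed

theorem theorem3p3:
  fixes f :: "real ^ 'n \<Rightarrow> real" and r :: "real \<Rightarrow> real"
    and lam alpha beta mu L F0 :: real
    and xs es :: "nat \<Rightarrow> real ^ 'n"
  assumes f_C2: "C2_on f UNIV"
    and lam: "lam > 0"
    and A1: "A1 r"
    and A2: "A2 (objective f r lam)"
    and F0: "F0 = smoothed_objective f r lam (xs 0) (es 0)"
    and A3: "bounded {x. objective f r lam x \<le> F0}"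
    and L: "\<forall>x y. objective f r lam x \<le> F0 \<longrightarrow> objective f r lam y \<le> F0 \<longrightarrow>
              norm (grad f x - grad f y) \<le> L * norm (x - y)"
    and eps0: "\<forall>i. es 0 $ i > 0"
    and alpha: "0 < alpha" "alpha < 1"
    and mu: "0 < mu" "mu < 1"
    and beta: "beta > alpha * L / 2" "beta > 0"
    and alg: "DIRL1 f r lam alpha beta mu xs es"
  shows "es \<longlonglongrightarrow> 0 \<and>
    limit_points xs \<noteq> {} \<and>
    (\<forall>x \<in> limit_points xs. stationary f r lam x)"
proof -
  obtain w y where w: "\<And>k i. w k $ i = deriv r (\<bar>xs k $ i\<bar> + es k $ i)"
    and y: "\<And>k. is_arg_min (subproblem f lam beta (xs k) (w k)) (\<lambda>_. True) (y k)"
    and xs: "\<And>k. xs (Suc k) = (1 - alpha) *\<^sub>R xs k + alpha *\<^sub>R y k"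
    and es: "\<And>k. es (Suc k) = (1 - alpha * (1 - mu)) *\<^sub>R es k"
    using alg unfolding DIRL1_def by blast
  have "alpha * (1 - mu) < 1 * 1" using alpha mu by (intro mult_strict_mono) auto
  moreover have "0 < alpha * (1 - mu)" using alpha mu by simp
  ultimately have q: "0 < 1 - alpha * (1 - mu)" "1 - alpha * (1 - mu) < 1" by auto
  note es_props = DIRL1_smoothing[where es = es, OF es q eps0[rule_format]]
  note df = C2_on_has_derivative_grad(1)[OF f_C2]
  define E where "E k = smoothed_objective f r lam (xs k) (es k)" for k
  define c where "c = alpha * (beta - alpha * L / 2)"
  have c: "c > 0" using alpha beta by (simp add: c_def)
  \<comment> \<open>Conditional, since the Lipschitz bound presupposes the level set; the induction
    for \<open>EF\<close> then discharges the condition, each decrease preserving it. Shrinking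
    \<open>es\<close> only lowers the value further.\<close>
  have step: "E (Suc k) \<le> E k - c * (norm (y k - xs k))\<^sup>2" if "E k \<le> F0" for k
  proof -
    have "xs (Suc k) = xs k + alpha *\<^sub>R (y k - xs k)" by (simp add: xs algebra_simps)
    then have "smoothed_objective f r lam (xs (Suc k)) (es k) \<le> E k - c * (norm (y k - xs k))\<^sup>2"
      using that unfolding E_def c_def
      by (simp only:) (intro DIRL1_step_decrease[OF A1 lam df L alpha beta es_props(1) w y])
    moreover have "E (Suc k) \<le> smoothed_objective f r lam (xs (Suc k)) (es k)"
      unfolding E_def
      by (intro smoothed_objective_mono A1 lam es_props less_imp_le[OF es_props(1)])
    ultimately show ?thesis by simp
  qed
  have EF: "E k \<le> F0" for k
  proof (induction k)
    case (Suc k)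
    have "0 \<le> c * (norm (y k - xs k))\<^sup>2" using c by simp
    then show ?case using step[OF Suc] Suc by simp
  qed (simp add: E_def F0)
  have obj: "objective f r lam (xs k) \<le> E k" for k
    unfolding E_def by (intro objective_le_smoothed A1 lam less_imp_le[OF es_props(1)])
  \<comment> \<open>The closure makes the bounded level set compact without a proof that the
    objective is continuous.\<close>
  define S where "S = closure {x. objective f r lam x \<le> F0}"
  have S: "compact S" using A3 by (simp add: S_def compact_closure)
  have xS: "xs k \<in> S" for k
  proof -
    have "objective f r lam (xs k) \<le> F0" using obj[of k] EF[of k] by simp
    then show ?thesis unfolding S_def using closure_subset by fastforce
  qed
  have "continuous_on S f"
    by (intro continuous_at_imp_continuous_on ballI has_derivative_continuous[OF df])
  then obtain m where m: "\<And>x. x \<in> S \<Longrightarrow> f m \<le> f x"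
    using continuous_attains_inf[OF S] xS by blast
  \<comment> \<open>The regularizer is nonnegative, so the minimum of \<open>f\<close> over
    \<open>S\<close> bounds the decreasing values from below.\<close>
  have "f m \<le> E k" for k
  proof -
    have "f (xs k) \<le> objective f r lam (xs k)"
      using lam by (simp add: objective_def sum_nonneg A1_nonneg[OF A1])
    then show ?thesis using m[OF xS] obj[of k] by (meson order_trans)
  qed
  then have d: "(\<lambda>k. y k - xs k) \<longlonglongrightarrow> 0"
    using step[OF EF] c by (intro sufficient_decrease_tendsto_0[of E c]) auto
  have "limit_points xs \<noteq> {}"
  proof -
    obtain l s where "strict_mono s" "(xs \<circ> s) \<longlonglongrightarrow> l"
      using S xS unfolding compact_def by metis
    then show ?thesis unfolding limit_points_def by blast
  qed
  moreover have "stationary f r lam x" if lp: "x \<in> limit_points xs" for x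
  proof -
    obtain s where s: "strict_mono s" "(xs \<circ> s) \<longlonglongrightarrow> x" using lp by (auto simp: limit_points_def)
    have lims: "(\<lambda>k. xs (s k)) \<longlonglongrightarrow> x" "(\<lambda>k. es (s k)) \<longlonglongrightarrow> 0" "(\<lambda>k. y (s k) - xs (s k)) \<longlonglongrightarrow> 0"
      using s(2) LIMSEQ_subseq_LIMSEQ[OF es_props(3) s(1)] LIMSEQ_subseq_LIMSEQ[OF d s(1)]
      by (auto simp: o_def)
    note first_order = limit_first_order_conditions[OF A1 lam beta(2) C2_on_has_derivative_grad(2)[OF f_C2],
        where X = "\<lambda>k. xs (s k)" and Y = "\<lambda>k. y (s k)" and W = "\<lambda>k. w (s k)" and E = "\<lambda>k. es (s k)",
        OF w es_props(1) y lims]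
    have "ereal (grad f x $ i) \<in> {- (ereal lam * deriv0 r) <..< ereal lam * deriv0 r}" if "x $ i = 0" for i
    proof (cases "deriv0 r")
      case (real R)
      have "\<bar>grad f x $ i\<bar> < lam * R"
        using first_order that by (intro A2_strict_bound[OF A1 real lam A2 df]) (auto simp: real)
      then show ?thesis by (auto simp: real)
    next
      case PInf
      then show ?thesis using lam by simp
    next
      case MInf
      then show ?thesis using A1 by (simp add: A1_def)
    qed
    then show ?thesis unfolding stationary_def using first_order(1) by blast
  qed
  ultimately show ?thesis using es_props(3) by blast
qed

end
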